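(* Let $K$ be a compact line. If $K$ is fragmentable, then $K$ is a Radon-Nikodým compact space.
   Context: A compact line is a linearly ordered set that is a compact space in the order topology (the topology generated by the base of open intervals). Let $X$ be a topological space and let $d:X\times X\to[0,\infty)$ be a metric on $X$; it is not assumed that the topology of $X$ coincides with the topology induced by $d$. The metric $d$ fragments $X$ if for every nonempty subset $Y\subset X$ and every $\varepsilon>0$ there exists a nonempty relatively open subset $V$ of $Y$ (open in the subspace topology inherited from the given topology of $X$) with $\sup\{d(x,y):x,y\in V\}<\varepsilon$. The metric $d$ is lower semicontinuous if for every $r>0$ the set $\{(x,y)\in X\times X: d(x,y)\le r\}$ is closed in $X\times X$ (product of the given topology of $X$). A compact space $K$ is fragmentable if there exists a metric on $K$ that fragments $K$. A compact space $K$ is Radon-Nikodým (RN) compact if there exists a lower semicontinuous metric on $K$ that fragments $K$. *)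

theory Defs
  imports "HOL-Analysis.Analysis"
begin

text \<open>The supremum is taken in the extended reals, so it is \<open>\<infinity>\<close> when \<open>d\<close> is unbounded on \<open>V\<close>.
  The topology \<open>X\<close> need not be the one induced by \<open>d\<close>.\<close>

definition fragments :: "('a \<Rightarrow> 'a \<Rightarrow> real) \<Rightarrow> 'a topology \<Rightarrow> bool" where
  "fragments d X \<longleftrightarrow>
    (\<forall>Y \<epsilon>. Y \<subseteq> topspace X \<and> Y \<noteq> {} \<and> \<epsilon> > 0 \<longrightarrow>
      (\<exists>V. openin (subtopology X Y) V \<and> V \<noteq> {} \<and>
           (SUP (x, y) \<in> V \<times> V. ereal (d x y)) < ereal \<epsilon>))"

definition lower_semicontinuous_metric :: "('a \<Rightarrow> 'a \<Rightarrow> real) \<Rightarrow> 'a topology \<Rightarrow> bool" where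
  "lower_semicontinuous_metric d X \<longleftrightarrow>
    (\<forall>r>0. closedin (prod_topology X X)
             {(x, y) \<in> topspace X \<times> topspace X. d x y \<le> r})"

definition fragmentable_compact :: "'a topology \<Rightarrow> bool" where
  "fragmentable_compact K \<longleftrightarrow>
    compact_space K \<and> (\<exists>d. Metric_space (topspace K) d \<and> fragments d K)"

definition Radon_Nikodym_compact :: "'a topology \<Rightarrow> bool" where
  "Radon_Nikodym_compact K \<longleftrightarrow>
    compact_space K \<and>
    (\<exists>d. Metric_space (topspace K) d \<and> lower_semicontinuous_metric d K \<and> fragments d K)"

end

theory Submission
  imports Defs
begin

text \<open>
  Call two points of a set \<open>S\<close> a gap of \<open>S\<close> if no point of \<open>S\<close> lies strictly between them. The proof
  rests on a sufficient condition for a compact line \<open>K\<close> to be Radon-Nikodym compact: there are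
  countably many closed, topologically scattered subsets \<open>S\<^sub>0, S\<^sub>1, \<dots>\<close> of \<open>K\<close> such that any two
  points \<open>x < y\<close> admit some \<open>S\<^sub>m\<close> with two points in \<open>[x, y]\<close>.

  Sufficiency (\<open>Radon_Nikodym_if_separated_by_scattered\<close>): for a gap \<open>a < b\<close> of \<open>S\<^sub>m\<close>, take a continuous
  \<open>f\<close> that is \<open>0\<close> up to \<open>a\<close> and \<open>1\<close> from \<open>b\<close> on. The supremum over all \<open>m\<close> and all gaps of
  \<open>2\<^sup>-\<^sup>m \<bar>f x - f y\<bar>\<close> is lower semicontinuous because it is a supremum of continuous functions, and
  it separates points because a compact scattered set with two points in \<open>[x, y]\<close> has a gap there.
  It fragments: a set \<open>Y\<close> not contained in \<open>S\<^sub>m\<close> meets an open interval \<open>(a, b)\<close> bounded by a gap,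
  on which only one function of the stage \<open>m\<close> varies, while a subset of \<open>S\<^sub>m\<close> has an isolated point.

  Construction: fragmentability exhausts \<open>K\<close>, for each \<open>n\<close>, by a well-ordered family of convex open
  sets such that the points for which a given member is the first one to contain them form a set of
  diameter below \<open>1/(n+1)\<close>. Write \<open>N\<^sub>n p\<close> for the first member that contains \<open>p\<close>. The main point is
  that if \<open>p\<close> ranges over the points above \<open>a\<close> with \<open>a \<in> N\<^sub>n p\<close>, then the right ends of the sets
  \<open>N\<^sub>n p\<close> form a well-ordered set (\<open>right_ends\<close>), and closures of well-ordered sets are scattered.
  Start with the two end points of \<open>K\<close>, and pass from \<open>S\<^sub>m\<close> to \<open>S\<^sub>m\<^sub>+\<^sub>1\<close> by inserting into each gap
  \<open>(a, b)\<close> the right ends seen from \<open>a\<close>, the left ends seen from \<open>b\<close>, both for \<open>n \<le> m\<close>, and a cofinal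
  and a coinitial set. Filling the gaps of a closed scattered set by closed scattered sets yields
  a closed scattered set (\<open>closed_scattered_fill_gaps\<close>).

  Separation (\<open>resolving_sequence_separates\<close>): if no \<open>S\<^sub>m\<close> has two points in \<open>[x, y]\<close>, there are
  gaps \<open>a\<^sub>m < b\<^sub>m\<close> of the \<open>S\<^sub>m\<close> around a nontrivial part of \<open>[x, y]\<close>; they converge monotonically to
  some \<open>p < q\<close>. For some \<open>n\<close>, say, \<open>q \<notin> N\<^sub>n p\<close>. As \<open>N\<^sub>n p\<close> is open, it contains \<open>a\<^sub>m\<close> for large
  \<open>m\<close>, so \<open>S\<^sub>m\<^sub>+\<^sub>1\<close> contains the right end of \<open>N\<^sub>n p\<close>, which lies in \<open>(p, q]\<close>. This forces
  \<open>b\<^sub>m\<^sub>+\<^sub>1 = q\<close>. The next stage is cofinal below \<open>q\<close>, so its gap around \<open>[p, q]\<close> has no inner point,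
  and both ends of that gap are in \<open>[x, y]\<close> after all.
\<close>

section \<open>Scattered sets\<close>

definition scattered :: "'a::topological_space set \<Rightarrow> bool" where
  "scattered S \<longleftrightarrow> (\<forall>Y\<subseteq>S. Y \<noteq> {} \<longrightarrow> (\<exists>U y. open U \<and> U \<inter> Y = {y}))"

definition order_convex :: "'a::linorder set \<Rightarrow> bool" where
  "order_convex A \<longleftrightarrow> (\<forall>x\<in>A. \<forall>y\<in>A. {x..y} \<subseteq> A)"

definition gap :: "'a::linorder set \<Rightarrow> 'a \<Rightarrow> 'a \<Rightarrow> bool" where
  "gap S a b \<longleftrightarrow> a \<in> S \<and> b \<in> S \<and> a < b \<and> S \<inter> {a<..<b} = {}"

lemma scatteredE:
  assumes "scattered S" "Y \<subseteq> S" "Y \<noteq> {}"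
  obtains U y where "open U" "U \<inter> Y = {y}"
  using assms unfolding scattered_def by metis

lemma scattered_empty_singleton [simp]: "scattered {}" "scattered {x}"
proof -
  show "scattered {}" by (simp add: scattered_def)
  show "scattered {x}"
    unfolding scattered_def
    by (metis Int_UNIV_left open_UNIV subset_singletonD)
qed

lemma scattered_Un:
  assumes "scattered A" "scattered B" "closed A"
  shows "scattered (A \<union> B)"
  unfolding scattered_def
proof (intro allI impI)
  fix Y assume Y: "Y \<subseteq> A \<union> B" "Y \<noteq> {}"
  show "\<exists>U y. open U \<and> U \<inter> Y = {y}"
  proof (cases "Y \<subseteq> A")
    case True
    then show ?thesis using scatteredE[OF assms(1) _ Y(2)] by metis
  next
    case False
    then have "Y - A \<subseteq> B" "Y - A \<noteq> {}" using Y(1) by auto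
    from scatteredE[OF assms(2) this] obtain U y where U: "open U" "U \<inter> (Y - A) = {y}" .
    have "open (U - A)" "(U - A) \<inter> Y = {y}"
      using U assms(3) by (auto simp: open_Diff)
    then show ?thesis by blast
  qed
qed

lemma scattered_UN_finite:
  assumes "finite I" "\<And>i. i \<in> I \<Longrightarrow> closed (A i) \<and> scattered (A i)"
  shows "scattered (\<Union>i\<in>I. A i)"
  using assms by (induction I rule: finite_induct) (auto intro!: scattered_Un)

text \<open>
  If \<open>Y\<close> has two points, let \<open>w\<close> be the least element of \<open>W\<close> above some point of \<open>Y\<close>. Then exactly one
  point of \<open>Y\<close> lies below \<open>w\<close>: between two such points and \<open>w\<close> there would be a smaller candidate.
\<close>

lemma scattered_closure_well_ordered:
  fixes W :: "'a::linorder_topology set"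
  assumes W: "\<And>Y. Y \<subseteq> W \<Longrightarrow> Y \<noteq> {} \<Longrightarrow> \<exists>m\<in>Y. \<forall>y\<in>Y. m \<le> y"
  shows "scattered (closure W)"
  unfolding scattered_def
proof (intro allI impI)
  fix Y assume Y: "Y \<subseteq> closure W" "Y \<noteq> {}"
  have meets: "\<exists>w\<in>W. w \<in> U" if "open U" "y \<in> U" "y \<in> Y" for U y
    using that Y(1) by (metis closure_iff_nhds_not_empty disjoint_iff subset_iff order_refl)
  show "\<exists>U y. open U \<and> U \<inter> Y = {y}"
  proof (cases "\<exists>y. Y = {y}")
    case True
    then show ?thesis by (metis Int_UNIV_left open_UNIV)
  next
    case False
    define Q where "Q = {w \<in> W. \<exists>y\<in>Y. y < w}"
    obtain y1 y2 where y12: "y1 \<in> Y" "y2 \<in> Y" "y1 < y2"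
      using False Y(2) by (metis insertI1 is_singletonI' is_singleton_def linorder_neqE)
    have "Q \<noteq> {}" using meets[of "{y1<..}" y2] y12 by (auto simp: Q_def)
    then obtain w where w: "w \<in> Q" "\<And>v. v \<in> Q \<Longrightarrow> w \<le> v"
      using W[of Q] by (auto simp: Q_def)
    then obtain y where y: "y \<in> Y" "y < w" by (auto simp: Q_def)
    have nolt: False if "z \<in> Y" "z' \<in> Y" "z < z'" "z' < w" for z z'
    proof -
      have "\<exists>v\<in>W. v \<in> {z<..<w}" by (rule meets[of _ z']) (use that in auto)
      then obtain v where "v \<in> W" "v \<in> {z<..<w}" by blast
      then have "v \<in> Q" "v < w" using that by (auto simp: Q_def)
      then show False using w(2) by force
    qed
    have "z = y" if "z \<in> Y" "z < w" for z
      using nolt[of z y] nolt[of y z] y that by (cases z y rule: linorder_cases) auto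
    then have "{..<w} \<inter> Y = {y}" using y by blast
    then show ?thesis by (metis open_lessThan)
  qed
qed

lemma scattered_closure_dually_well_ordered:
  fixes W :: "'a::linorder_topology set"
  assumes W: "\<And>Y. Y \<subseteq> W \<Longrightarrow> Y \<noteq> {} \<Longrightarrow> \<exists>m\<in>Y. \<forall>y\<in>Y. y \<le> m"
  shows "scattered (closure W)"
  unfolding scattered_def
proof (intro allI impI)
  fix Y assume Y: "Y \<subseteq> closure W" "Y \<noteq> {}"
  have meets: "\<exists>w\<in>W. w \<in> U" if "open U" "y \<in> U" "y \<in> Y" for U y
    using that Y(1) by (metis closure_iff_nhds_not_empty disjoint_iff subset_iff order_refl)
  show "\<exists>U y. open U \<and> U \<inter> Y = {y}"
  proof (cases "\<exists>y. Y = {y}")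
    case True
    then show ?thesis by (metis Int_UNIV_left open_UNIV)
  next
    case False
    define Q where "Q = {w \<in> W. \<exists>y\<in>Y. w < y}"
    obtain y1 y2 where y12: "y1 \<in> Y" "y2 \<in> Y" "y1 < y2"
      using False Y(2) by (metis insertI1 is_singletonI' is_singleton_def linorder_neqE)
    have "Q \<noteq> {}" using meets[of "{..<y2}" y1] y12 by (auto simp: Q_def)
    then obtain w where w: "w \<in> Q" "\<And>v. v \<in> Q \<Longrightarrow> v \<le> w"
      using W[of Q] by (auto simp: Q_def)
    then obtain y where y: "y \<in> Y" "w < y" by (auto simp: Q_def)
    have nolt: False if "z \<in> Y" "z' \<in> Y" "z < z'" "w < z" for z z'
    proof -
      have "\<exists>v\<in>W. v \<in> {w<..<z'}" by (rule meets[of _ z]) (use that in auto)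
      then obtain v where "v \<in> W" "v \<in> {w<..<z'}" by blast
      then have "v \<in> Q" "w < v" using that by (auto simp: Q_def)
      then show False using w(2) by force
    qed
    have "z = y" if "z \<in> Y" "w < z" for z
      using nolt[of z y] nolt[of y z] y that by (cases z y rule: linorder_cases) auto
    then have "{w<..} \<inter> Y = {y}" using y by blast
    then show ?thesis by (metis open_greaterThan)
  qed
qed

section \<open>Gaps of closed subsets of a compact line\<close>

lemma gap_unique:
  assumes "gap S a b" "gap S a' b'" "a < z" "z < b" "a' \<le> z" "z \<le> b'" "z \<notin> S"
  shows "a' = a" "b' = b"
proof -
  have z': "a' < z" "z < b'" using assms unfolding gap_def by (metis order_le_less)+
  show "a' = a" "b' = b"
    using assms z' unfolding gap_def disjoint_iff greaterThanLessThan_iff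
    by (metis linorder_neqE less_trans)+
qed

lemma gap_around:
  fixes S :: "'a::linorder_topology set"
  assumes "compact (UNIV :: 'a set)" "closed S" "l \<in> S" "u \<in> S" "l \<le> x" "y \<le> u" "x \<le> y"
    and "x < y \<or> x \<notin> S" "S \<inter> {x<..<y} = {}"
  obtains a b where "gap S a b" "a \<le> x" "y \<le> b"
proof -
  have comp: "compact (S \<inter> {..x})" "compact (S \<inter> {y..})"
    using assms(1,2) by (metis Int_UNIV_left closed_Int closed_atLeast closed_atMost compact_Int_closed)+
  obtain a where a: "a \<in> S \<inter> {..x}" "\<And>z. z \<in> S \<inter> {..x} \<Longrightarrow> z \<le> a"
    using compact_attains_sup[OF comp(1)] assms(3,5) by blast
  obtain b where b: "b \<in> S \<inter> {y..}" "\<And>z. z \<in> S \<inter> {y..} \<Longrightarrow> b \<le> z"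
    using compact_attains_inf[OF comp(2)] assms(4,6) by blast
  have ab: "a < b" using a(1) b(1) assms(7,8)
    by (metis IntE atLeast_iff atMost_iff order.strict_trans1 order.strict_trans2 order_le_less)
  have "False" if "z \<in> S" "a < z" "z < b" for z
    using a(2)[of z] b(2)[of z] that assms(9) by (force simp: not_le[symmetric])
  then have "gap S a b" using ab a(1) b(1) by (auto simp: gap_def)
  then show thesis using that a(1) b(1) by auto
qed

text \<open>
  A point outside \<open>S\<close> lies in a unique open interval bounded by a gap of \<open>S\<close>, and there the new set
  agrees with \<open>X a b\<close>. So both properties are local, except for subsets of \<open>S\<close>, which have
  isolated points because \<open>S\<close> is scattered.
\<close>

lemma closed_scattered_fill_gaps:
  fixes S :: "'a::linorder_topology set"
  assumes K: "compact (UNIV :: 'a set)" and S: "closed S" "scattered S"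
    and lu: "l \<in> S" "u \<in> S" "\<And>x. l \<le> x" "\<And>x. x \<le> u"
    and X: "\<And>a b. gap S a b \<Longrightarrow> closed (X a b) \<and> scattered (X a b)"
  defines "T \<equiv> S \<union> (\<Union>(a, b)\<in>{(a, b). gap S a b}. X a b \<inter> {a..b})"
  shows "closed T" "scattered T"
proof -
  have around: "\<exists>a b. gap S a b \<and> a < y \<and> y < b" if y: "y \<notin> S" for y
  proof -
    obtain a b where ab: "gap S a b" "a \<le> y" "y \<le> b"
      using gap_around[OF K S(1) lu(1,2) lu(3,4), of y y] y by auto
    then show ?thesis using y unfolding gap_def by (metis order_le_less)
  qed
  have local: "T \<inter> {a<..<b} \<subseteq> X a b" if "gap S a b" for a b
  proof
    fix z assume z: "z \<in> T \<inter> {a<..<b}"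
    then have zS: "z \<notin> S" using that by (auto simp: gap_def)
    then obtain a' b' where g: "gap S a' b'" "z \<in> X a' b'" "a' \<le> z" "z \<le> b'"
      using z by (auto simp: T_def)
    then show "z \<in> X a b" using gap_unique[OF that g(1) _ _ g(3,4) zS] z by auto
  qed
  have "open (- T)"
  proof (subst open_subopen, intro ballI)
    fix y assume y: "y \<in> - T"
    then obtain a b where g: "gap S a b" "a < y" "y < b" using around[of y] by (auto simp: T_def)
    let ?U = "{a<..<b} - X a b"
    have "open ?U" using X[OF g(1)] by (simp add: open_Diff)
    moreover have "y \<in> ?U" using y g less_imp_le[OF g(2)] less_imp_le[OF g(3)] by (auto simp: T_def)
    moreover have "?U \<subseteq> - T" using local[OF g(1)] by auto
    ultimately show "\<exists>U. open U \<and> y \<in> U \<and> U \<subseteq> - T" by blast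
  qed
  then show "closed T" by (simp add: closed_def)
  show "scattered T"
    unfolding scattered_def
  proof (intro allI impI)
    fix Y assume Y: "Y \<subseteq> T" "Y \<noteq> {}"
    show "\<exists>U y. open U \<and> U \<inter> Y = {y}"
    proof (cases "Y \<subseteq> S")
      case True
      then show ?thesis using scatteredE[OF S(2) _ Y(2)] by metis
    next
      case False
      then obtain y a b where g: "y \<in> Y" "gap S a b" "a < y" "y < b"
        using around by blast
      have "Y \<inter> {a<..<b} \<subseteq> X a b" "Y \<inter> {a<..<b} \<noteq> {}" using local[OF g(2)] Y(1) g by auto
      then obtain U z where "open U" "U \<inter> (Y \<inter> {a<..<b}) = {z}"
        using scatteredE X[OF g(2)] by metis
      then have "open (U \<inter> {a<..<b})" "(U \<inter> {a<..<b}) \<inter> Y = {z}" by auto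
      then show ?thesis by blast
    qed
  qed
qed

text \<open>
  An isolated point of \<open>S \<inter> {u..v}\<close> has a neighbour in the order: the other points form a compact
  set, so there is a nearest one above it, or, if the isolated point is \<open>v\<close>, a nearest one below it.
\<close>

lemma gap_between:
  fixes S :: "'a::linorder_topology set"
  assumes K: "compact (UNIV :: 'a set)" and S: "closed S" "scattered S"
    and uv: "u \<in> S" "v \<in> S" "u < v"
  obtains a b where "gap S a b" "u \<le> a" "b \<le> v"
proof -
  let ?Y = "S \<inter> {u..v}"
  have "?Y \<subseteq> S" "?Y \<noteq> {}" using uv by auto
  from scatteredE[OF S(2) this] obtain U e where U: "open U" "U \<inter> ?Y = {e}" .
  have e: "e \<in> U" "e \<in> S" "u \<le> e" "e \<le> v" using U(2) by auto
  have comp: "compact (C :: 'a set)" if "closed C" for C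
    using compact_Int_closed[OF K that] by simp
  show thesis
  proof (cases "e < v")
    case True
    let ?C = "?Y \<inter> {e..} - U"
    have "closed ?C" using S(1) U(1) by (simp add: closed_Diff closed_Int)
    moreover have "v \<in> ?C" using True U(2) uv by auto
    ultimately obtain b where b: "b \<in> ?C" "\<And>z. z \<in> ?C \<Longrightarrow> b \<le> z"
      using compact_attains_inf[OF comp, of ?C] by blast
    have "False" if "z \<in> S" "e < z" "z < b" for z
    proof -
      have "z \<in> ?Y" using that b(1) e by auto
      moreover have "z \<notin> U" using U(2) calculation that(2) by (metis IntI singletonD order_less_irrefl)
      ultimately show False using b(2)[of z] that less_imp_le[OF that(2)] by auto
    qed
    moreover have "e < b" using b(1) e(1) by (metis DiffE IntE atLeast_iff order_le_less)
    ultimately have "gap S e b" using e b(1) by (auto simp: gap_def)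
    then show thesis using that[of e b] e b(1) by auto
  next
    case False
    then have ev: "e = v" using e by auto
    let ?C = "?Y - U"
    have "closed ?C" using S(1) U(1) by (simp add: closed_Diff closed_Int)
    moreover have "u \<in> ?C" using ev U(2) uv by auto
    ultimately obtain a where a: "a \<in> ?C" "\<And>z. z \<in> ?C \<Longrightarrow> z \<le> a"
      using compact_attains_sup[OF comp, of ?C] by blast
    have "False" if "z \<in> S" "a < z" "z < v" for z
    proof -
      have "z \<in> ?Y" using that a(1) e by auto
      moreover have "z \<notin> U" using U(2) calculation that(3) ev by (metis IntI singletonD order_less_irrefl)
      ultimately show False using a(2)[of z] that by auto
    qed
    moreover have "a < v" using a(1) e(1) ev by (metis DiffE IntE atLeastAtMost_iff order_le_less)
    ultimately have "gap S a v" using uv a(1) by (auto simp: gap_def)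
    then show thesis using that[of a v] a(1) by auto
  qed
qed

section \<open>Ranked neighbourhoods from fragmentability\<close>

lemma open_contains_order_convex:
  fixes x :: "'a::linorder_topology"
  assumes U: "open U" "x \<in> U"
  obtains I where "open I" "order_convex I" "x \<in> I" "I \<subseteq> U"
proof -
  obtain A where A: "open A" "order_convex A" "x \<in> A" "A \<inter> {..x} \<subseteq> U"
  proof (cases "\<exists>l. l < x")
    case True
    then obtain l where "l < x" "{l<..x} \<subseteq> U" using open_left[OF U] by blast
    then have "{l<..} \<inter> {..x} \<subseteq> U" by (simp add: greaterThanAtMost_def)
    moreover have "order_convex {l<..}" by (auto simp: order_convex_def)
    ultimately show thesis using that[of "{l<..}"] \<open>l < x\<close> by auto
  next
    case False
    then have "{..x} = {x}" by (auto simp: not_less intro: order.antisym)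
    then show thesis using that[of UNIV] U by (auto simp: order_convex_def)
  qed
  obtain B where B: "open B" "order_convex B" "x \<in> B" "B \<inter> {x..} \<subseteq> U"
  proof (cases "\<exists>r. x < r")
    case True
    then obtain r where "x < r" "{x..<r} \<subseteq> U" using open_right[OF U] by blast
    then have "{..<r} \<inter> {x..} \<subseteq> U" by (simp add: atLeastLessThan_def Int_commute)
    moreover have "order_convex {..<r}" by (auto simp: order_convex_def)
    ultimately show thesis using that[of "{..<r}"] \<open>x < r\<close> by auto
  next
    case False
    then have "{x..} = {x}" by (auto simp: not_less intro: order.antisym)
    then show thesis using that[of UNIV] U by (auto simp: order_convex_def)
  qed
  have "A \<inter> B \<subseteq> U"
  proof
    fix z assume "z \<in> A \<inter> B"
    then show "z \<in> U" using A(4) B(4) by (cases "z \<le> x") auto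
  qed
  moreover have "order_convex (A \<inter> B)" using A(2) B(2) by (force simp: order_convex_def)
  ultimately show thesis using that[of "A \<inter> B"] A B by auto
qed

text \<open>
  This records all that is needed of a well-ordered exhaustion of the line by convex open sets when
  \<open>N p\<close> is the first member containing \<open>p\<close>: a point \<open>q \<in> N p\<close> has its own first member no later than
  \<open>N p\<close>. The relation \<open>L\<close> compares the positions of the first members.
\<close>

definition ranked :: "('a::linorder_topology \<Rightarrow> 'a set) \<Rightarrow> bool" where
  "ranked N \<longleftrightarrow> (\<forall>p. open (N p) \<and> order_convex (N p) \<and> p \<in> N p) \<and>
     (\<exists>L. wf L \<and> (\<forall>p. \<forall>q\<in>N p. (q, p) \<in> L \<or> N q = N p))"

text \<open>
  Transfinite recursion: as long as the union \<open>G\<close> of the earlier sets is not everything,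
  fragmentability applied to \<open>- G\<close> gives a convex open \<open>I G\<close> for which \<open>I G - G\<close> is nonempty and
  has diameter below \<open>\<epsilon>\<close>. The stages are indexed by a well-order of the sets of points rather than
  of the points themselves, so that Cantor's theorem makes the recursion exhaust the line.
\<close>

lemma ranked_neighbourhoods:
  fixes d :: "'a::linorder_topology \<Rightarrow> 'a \<Rightarrow> real"
  assumes frag: "fragments d (euclidean :: 'a topology)" and "\<epsilon> > 0"
  obtains N where "ranked N" "\<And>p q. N p = N q \<Longrightarrow> d p q < \<epsilon>"
proof -
  have "\<exists>I. open I \<and> order_convex I \<and> (G \<noteq> UNIV \<longrightarrow> I - G \<noteq> {}) \<and> (\<forall>p\<in>I - G. \<forall>q\<in>I - G. d p q < \<epsilon>)"
    if G: "open G" for G :: "'a set"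
  proof (cases "G = UNIV")
    case True
    then show ?thesis by (intro exI[of _ UNIV]) (auto simp: order_convex_def)
  next
    case False
    then obtain V where V: "openin (subtopology euclidean (- G)) V" "V \<noteq> {}"
        "(SUP (x, y) \<in> V \<times> V. ereal (d x y)) < ereal \<epsilon>"
      using frag \<open>\<epsilon> > 0\<close> unfolding fragments_def topspace_euclidean
      by (metis Compl_eq_Diff_UNIV Diff_eq_empty_iff subset_UNIV top.extremum_uniqueI)
    then obtain U where U: "open U" "V = - G \<inter> U" by (auto simp: openin_open)
    obtain x where x: "x \<in> V" using V(2) by blast
    obtain I where I: "open I" "order_convex I" "x \<in> I" "I \<subseteq> U"
      using open_contains_order_convex[OF U(1)] x U(2) by blast
    have "d p q < \<epsilon>" if "p \<in> I - G" "q \<in> I - G" for p q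
    proof -
      have "(p, q) \<in> V \<times> V" using that U(2) I(4) by auto
      then have "ereal (d p q) \<le> (SUP (x, y) \<in> V \<times> V. ereal (d x y))"
        by (rule SUP_upper2) simp
      then show ?thesis using V(3) by (metis less_ereal.simps(1) order.strict_trans1)
    qed
    then show ?thesis using I x U(2) by blast
  qed
  then obtain I where I: "\<And>G :: 'a set. open G \<Longrightarrow> open (I G) \<and> order_convex (I G) \<and>
      (G \<noteq> UNIV \<longrightarrow> I G - G \<noteq> {}) \<and> (\<forall>p\<in>I G - G. \<forall>q\<in>I G - G. d p q < \<epsilon>)"
    by metis
  obtain r :: "'a set rel" where "well_order_on UNIV r" using well_order_on by blast
  define R where "R = r - Id"
  have wf: "wf R" and tot: "\<And>i j. i \<noteq> j \<Longrightarrow> (i, j) \<in> R \<or> (j, i) \<in> R"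
    using \<open>well_order_on UNIV r\<close>
    by (auto simp: R_def well_order_on_def linear_order_on_def total_on_def)
  define J where "J = wfrec R (\<lambda>f i. I (\<Union>j\<in>{j. (j, i) \<in> R}. f j))"
  define G where "G i = (\<Union>j\<in>{j. (j, i) \<in> R}. J j)" for i
  have J: "J i = I (G i)" for i
  proof -
    have "J i = I (\<Union>j\<in>{j. (j, i) \<in> R}. cut J R i j)"
      unfolding J_def by (subst wfrec[OF wf]) simp
    also have "(\<Union>j\<in>{j. (j, i) \<in> R}. cut J R i j) = G i"
      unfolding G_def by (intro SUP_cong) (auto simp: cut_apply)
    finally show ?thesis .
  qed
  have openJ: "open (J i)" for i
    using wf
  proof (induction i rule: wf_induct_rule)
    case (less i)
    then have "open (G i)" by (auto simp: G_def)
    then show ?case using I J by metis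
  qed
  then have openG: "open (G i)" for i by (auto simp: G_def)
  note IG = I[OF openG, folded J]
  have cover: "\<exists>i. p \<in> J i" for p
  proof (rule ccontr)
    assume p: "\<nexists>i. p \<in> J i"
    then have "p \<notin> G i" for i by (auto simp: G_def)
    then have "\<exists>x. x \<in> J i - G i" for i using IG[of i] by blast
    \<comment> \<open>If some point is never reached, every stage adds a new point, so there are too many points.\<close>
    then obtain g where g: "\<And>i. g i \<in> J i - G i" by metis
    have "g i \<noteq> g j" if "(i, j) \<in> R" for i j
    proof -
      have "J i \<subseteq> G j" using that by (auto simp: G_def)
      then show ?thesis using g[of i] g[of j] by auto
    qed
    then have "inj g" using tot by (metis injI)
    then have "range (inv g) = Pow UNIV" using inj_imp_surj_inv by auto
    then show False using Cantors_theorem[of "UNIV :: 'a set"] by blast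
  qed
  \<comment> \<open>The first stage that contains \<open>p\<close> serves as its rank.\<close>
  have "\<exists>i. p \<in> J i \<and> p \<notin> G i" for p
  proof -
    obtain i where "i \<in> {i. p \<in> J i}" "\<And>j. (j, i) \<in> R \<Longrightarrow> j \<notin> {i. p \<in> J i}"
      using cover[of p] wfE_min[OF wf, of _ "{i. p \<in> J i}"] by (metis mem_Collect_eq)
    then show ?thesis by (auto simp: G_def)
  qed
  then obtain \<rho> where \<rho>: "\<And>p. p \<in> J (\<rho> p)" "\<And>p. p \<notin> G (\<rho> p)" by metis
  have later: "q \<notin> J (\<rho> p)" if "(\<rho> p, \<rho> q) \<in> R" for p q
    using \<rho>(2)[of q] that unfolding G_def by blast
  define N where "N p = J (\<rho> p)" for p
  have "wf (inv_image R \<rho>)" using wf by (rule wf_inv_image)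
  moreover have "(q, p) \<in> inv_image R \<rho> \<or> N q = N p" if "q \<in> N p" for p q
    using that later[of p q] tot[of "\<rho> p" "\<rho> q"]
    by (cases "\<rho> p = \<rho> q") (auto simp: N_def)
  moreover have "open (N p) \<and> order_convex (N p) \<and> p \<in> N p" for p
    using IG[of "\<rho> p"] \<rho>(1) by (auto simp: N_def)
  ultimately have "ranked N" unfolding ranked_def by blast
  moreover have "d p q < \<epsilon>" if "N p = N q" for p q
  proof -
    have "\<rho> p = \<rho> q"
      using that later[of p q] later[of q p] tot[of "\<rho> p" "\<rho> q"] \<rho>(1)[of p] \<rho>(1)[of q]
      by (auto simp: N_def)
    then show ?thesis using IG[of "\<rho> p"] \<rho>[of p] \<rho>[of q] by auto
  qed
  ultimately show thesis using that by blast
qed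

lemma rankedD:
  assumes "ranked N"
  shows "open (N p)" "order_convex (N p)" "p \<in> N p"
  using assms unfolding ranked_def by blast+

lemma ranked_mutual_imp_eq:
  assumes "ranked N" "q \<in> N p" "p \<in> N q"
  shows "N p = N q"
proof -
  obtain L where "wf L" "\<forall>p. \<forall>q\<in>N p. (q, p) \<in> L \<or> N q = N p"
    using assms(1) unfolding ranked_def by blast
  then show ?thesis using assms(2,3) by (metis wf_not_sym)
qed

section \<open>Scattered sets of end points\<close>

text \<open>
  Let \<open>c p\<close> be the first point above \<open>p\<close> outside \<open>N p\<close>. Choose \<open>p\<close> of least rank among the points
  with \<open>c p\<close> in a given set of ends. A strictly smaller end \<open>c p'\<close> would lie in \<open>N p\<close> together with
  \<open>p'\<close>, because \<open>N p\<close> contains everything from \<open>a\<close> up to \<open>c p\<close>; minimality then gives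
  \<open>N p' = N p\<close>, contradicting \<open>c p' \<notin> N p'\<close>. So the ends are well-ordered.
\<close>

lemma right_ends:
  fixes a :: "'a::linorder_topology"
  assumes K: "compact (UNIV :: 'a set)" and N: "ranked N"
  obtains X where "closed X" "scattered X"
    "\<And>p q. \<lbrakk>a \<le> p; p < q; a \<in> N p; q \<notin> N p\<rbrakk> \<Longrightarrow> \<exists>c\<in>X. p < c \<and> c \<le> q"
proof -
  obtain L where L: "wf L" "\<And>p q. q \<in> N p \<Longrightarrow> (q, p) \<in> L \<or> N q = N p"
    using N unfolding ranked_def by blast
  define P where "P = {p. a \<le> p \<and> a \<in> N p \<and> (\<exists>q>p. q \<notin> N p)}"
  have "\<exists>c. p < c \<and> c \<notin> N p \<and> {p..<c} \<subseteq> N p" if p: "p \<in> P" for p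
  proof -
    have "compact ({p..} - N p)"
      using compact_Int_closed[OF K, of "{p..} - N p"] rankedD(1)[OF N] by (simp add: closed_Diff)
    moreover have "{p..} - N p \<noteq> {}" using p by (auto simp: P_def intro: less_imp_le)
    ultimately obtain c where c: "c \<in> {p..} - N p" "\<And>z. z \<in> {p..} - N p \<Longrightarrow> c \<le> z"
      using compact_attains_inf by metis
    have "p < c" using c(1) rankedD(3)[OF N, of p] by (metis DiffE atLeast_iff order_le_less)
    moreover have "{p..<c} \<subseteq> N p"
      using c(2) by (metis DiffI atLeastLessThan_iff atLeast_iff leD subsetI)
    ultimately show ?thesis using c(1) by auto
  qed
  then obtain c where c: "\<And>p. p \<in> P \<Longrightarrow> p < c p \<and> c p \<notin> N p \<and> {p..<c p} \<subseteq> N p" by metis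
  have "\<exists>m\<in>Y. \<forall>y\<in>Y. m \<le> y" if Y: "Y \<subseteq> c ` P" "Y \<noteq> {}" for Y
  proof -
    define Q where "Q = {p \<in> P. c p \<in> Y}"
    have "Q \<noteq> {}" using Y by (auto simp: Q_def)
    then obtain p where "p \<in> Q" "\<And>p'. (p', p) \<in> L \<Longrightarrow> p' \<notin> Q"
      using wfE_min[OF L(1)] by (metis ex_in_conv)
    then have p: "p \<in> P" "c p \<in> Y" "\<And>p'. p' \<in> P \<Longrightarrow> c p' \<in> Y \<Longrightarrow> (p', p) \<notin> L"
      by (auto simp: Q_def)
    have "c p \<le> c p'" if p': "p' \<in> P" "c p' \<in> Y" for p'
    proof (rule ccontr)
      assume "\<not> c p \<le> c p'"
      then have less: "c p' < c p" by simp
      have "{a..p} \<subseteq> N p"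
        using p(1) rankedD(2,3)[OF N, of p] unfolding P_def order_convex_def by blast
      then have sub: "z \<in> N p" if "a \<le> z" "z < c p" for z
        using c[OF p(1)] that by (cases "z \<le> p") auto
      have "a \<le> p'" "p' < c p'" using p'(1) c[OF p'(1)] by (auto simp: P_def)
      then have in_N: "p' \<in> N p" "c p' \<in> N p" using sub[of p'] sub[of "c p'"] less by auto
      then have "N p' = N p" using L(2) p(3)[OF p'] by blast
      then show False using in_N(2) c[OF p'(1)] by auto
    qed
    then show ?thesis using p(2) Y(1) by (metis imageE subsetD)
  qed
  then have "scattered (closure (c ` P))" by (rule scattered_closure_well_ordered)
  moreover have "\<exists>z\<in>closure (c ` P). p < z \<and> z \<le> q"
    if "a \<le> p" "p < q" "a \<in> N p" "q \<notin> N p" for p q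
  proof -
    have p: "p \<in> P" using that by (auto simp: P_def)
    then have "c p \<in> closure (c ` P)" using closure_subset[of "c ` P"] by auto
    moreover have "c p \<le> q" using c[OF p] that by (meson atLeastLessThan_iff less_imp_le not_le subsetD)
    ultimately show ?thesis using c[OF p] by blast
  qed
  ultimately show thesis by (rule that[OF closed_closure])
qed

text \<open>The mirror image, with the last points below \<open>p\<close> outside \<open>N p\<close>.\<close>

lemma left_ends:
  fixes b :: "'a::linorder_topology"
  assumes K: "compact (UNIV :: 'a set)" and N: "ranked N"
  obtains X where "closed X" "scattered X"
    "\<And>p q. \<lbrakk>p \<le> b; q < p; b \<in> N p; q \<notin> N p\<rbrakk> \<Longrightarrow> \<exists>c\<in>X. q \<le> c \<and> c < p"
proof -
  obtain L where L: "wf L" "\<And>p q. q \<in> N p \<Longrightarrow> (q, p) \<in> L \<or> N q = N p"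
    using N unfolding ranked_def by blast
  define P where "P = {p. p \<le> b \<and> b \<in> N p \<and> (\<exists>q<p. q \<notin> N p)}"
  have "\<exists>c. c < p \<and> c \<notin> N p \<and> {c<..p} \<subseteq> N p" if p: "p \<in> P" for p
  proof -
    have "compact ({..p} - N p)"
      using compact_Int_closed[OF K, of "{..p} - N p"] rankedD(1)[OF N] by (simp add: closed_Diff)
    moreover have "{..p} - N p \<noteq> {}" using p by (auto simp: P_def intro: less_imp_le)
    ultimately obtain c where c: "c \<in> {..p} - N p" "\<And>z. z \<in> {..p} - N p \<Longrightarrow> z \<le> c"
      using compact_attains_sup by metis
    have "c < p" using c(1) rankedD(3)[OF N, of p] by (metis DiffE atMost_iff order_le_less)
    moreover have "{c<..p} \<subseteq> N p"
      using c(2) by (metis DiffI greaterThanAtMost_iff atMost_iff leD subsetI)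
    ultimately show ?thesis using c(1) by auto
  qed
  then obtain c where c: "\<And>p. p \<in> P \<Longrightarrow> c p < p \<and> c p \<notin> N p \<and> {c p<..p} \<subseteq> N p" by metis
  have "\<exists>m\<in>Y. \<forall>y\<in>Y. y \<le> m" if Y: "Y \<subseteq> c ` P" "Y \<noteq> {}" for Y
  proof -
    define Q where "Q = {p \<in> P. c p \<in> Y}"
    have "Q \<noteq> {}" using Y by (auto simp: Q_def)
    then obtain p where "p \<in> Q" "\<And>p'. (p', p) \<in> L \<Longrightarrow> p' \<notin> Q"
      using wfE_min[OF L(1)] by (metis ex_in_conv)
    then have p: "p \<in> P" "c p \<in> Y" "\<And>p'. p' \<in> P \<Longrightarrow> c p' \<in> Y \<Longrightarrow> (p', p) \<notin> L"
      by (auto simp: Q_def)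
    have "c p' \<le> c p" if p': "p' \<in> P" "c p' \<in> Y" for p'
    proof (rule ccontr)
      assume "\<not> c p' \<le> c p"
      then have less: "c p < c p'" by simp
      have "{p..b} \<subseteq> N p"
        using p(1) rankedD(2,3)[OF N, of p] unfolding P_def order_convex_def by blast
      then have sub: "z \<in> N p" if "z \<le> b" "c p < z" for z
        using c[OF p(1)] that by (cases "z \<le> p") auto
      have "p' \<le> b" "c p' < p'" using p'(1) c[OF p'(1)] by (auto simp: P_def)
      then have in_N: "p' \<in> N p" "c p' \<in> N p" using sub[of p'] sub[of "c p'"] less by auto
      then have "N p' = N p" using L(2) p(3)[OF p'] by blast
      then show False using in_N(2) c[OF p'(1)] by auto
    qed
    then show ?thesis using p(2) Y(1) by (metis imageE subsetD)
  qed
  then have "scattered (closure (c ` P))" by (rule scattered_closure_dually_well_ordered)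
  moreover have "\<exists>z\<in>closure (c ` P). q \<le> z \<and> z < p"
    if "p \<le> b" "q < p" "b \<in> N p" "q \<notin> N p" for p q
  proof -
    have p: "p \<in> P" using that by (auto simp: P_def)
    then have "c p \<in> closure (c ` P)" using closure_subset[of "c ` P"] by auto
    moreover have "q \<le> c p" using c[OF p] that by (meson greaterThanAtMost_iff less_imp_le not_le subsetD)
    ultimately show ?thesis using c[OF p] by blast
  qed
  ultimately show thesis by (rule that[OF closed_closure])
qed

text \<open>
  Fix any well-order \<open>R\<close> of the points and keep the records of \<open>T\<close>: the points that are larger in the
  line than all \<open>R\<close>-earlier points of \<open>T\<close>. On the records the line order agrees with \<open>R\<close>, and the
  \<open>R\<close>-first point of \<open>T\<close> above a given \<open>t\<close> is a record.
\<close>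

lemma cofinal_scattered:
  fixes T :: "'a::linorder_topology set"
  obtains X where "closed X" "scattered X" "\<And>t. t \<in> T \<Longrightarrow> \<exists>z\<in>X \<inter> T. t \<le> z"
proof -
  obtain r :: "'a rel" where "well_order_on UNIV r" using well_order_on by blast
  define R where "R = r - Id"
  have wf: "wf R" and tot: "\<And>i j. i \<noteq> j \<Longrightarrow> (i, j) \<in> R \<or> (j, i) \<in> R"
    using \<open>well_order_on UNIV r\<close>
    by (auto simp: R_def well_order_on_def linear_order_on_def total_on_def)
  define W where "W = {x \<in> T. \<forall>y\<in>T. (y, x) \<in> R \<longrightarrow> y < x}"
  have "\<exists>m\<in>Y. \<forall>y\<in>Y. m \<le> y" if Y: "Y \<subseteq> W" "Y \<noteq> {}" for Y
  proof -
    obtain m where m: "m \<in> Y" "\<And>y. y \<in> Y \<Longrightarrow> (y, m) \<notin> R"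
      using wfE_min[OF wf] Y(2) by (metis ex_in_conv)
    have "m \<le> y" if y: "y \<in> Y" for y
    proof (cases "y = m")
      case False
      then have "(m, y) \<in> R" using tot[of m y] m(2)[OF y] by blast
      moreover have "m \<in> W" "y \<in> W" using m(1) y Y(1) by auto
      ultimately have "m < y" by (auto simp: W_def)
      then show ?thesis by simp
    qed simp
    then show ?thesis using m(1) by blast
  qed
  then have "scattered (closure W)" by (rule scattered_closure_well_ordered)
  moreover have "\<exists>z\<in>closure W \<inter> T. t \<le> z" if t: "t \<in> T" for t
  proof -
    define Q where "Q = {x \<in> T. t \<le> x}"
    have "Q \<noteq> {}" using t by (auto simp: Q_def)
    then obtain z where "z \<in> Q" "\<And>y. (y, z) \<in> R \<Longrightarrow> y \<notin> Q"
      using wfE_min[OF wf] by (metis ex_in_conv)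
    then have z: "z \<in> T" "t \<le> z" "\<And>y. (y, z) \<in> R \<Longrightarrow> y \<in> T \<Longrightarrow> \<not> t \<le> y"
      by (auto simp: Q_def)
    have "z \<in> W" using z unfolding W_def by force
    then show ?thesis using z(1,2) closure_subset[of W] by auto
  qed
  ultimately show thesis by (rule that[OF closed_closure])
qed

lemma coinitial_scattered:
  fixes T :: "'a::linorder_topology set"
  obtains X where "closed X" "scattered X" "\<And>t. t \<in> T \<Longrightarrow> \<exists>z\<in>X \<inter> T. z \<le> t"
proof -
  obtain r :: "'a rel" where "well_order_on UNIV r" using well_order_on by blast
  define R where "R = r - Id"
  have wf: "wf R" and tot: "\<And>i j. i \<noteq> j \<Longrightarrow> (i, j) \<in> R \<or> (j, i) \<in> R"
    using \<open>well_order_on UNIV r\<close>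
    by (auto simp: R_def well_order_on_def linear_order_on_def total_on_def)
  define W where "W = {x \<in> T. \<forall>y\<in>T. (y, x) \<in> R \<longrightarrow> x < y}"
  have "\<exists>m\<in>Y. \<forall>y\<in>Y. y \<le> m" if Y: "Y \<subseteq> W" "Y \<noteq> {}" for Y
  proof -
    obtain m where m: "m \<in> Y" "\<And>y. y \<in> Y \<Longrightarrow> (y, m) \<notin> R"
      using wfE_min[OF wf] Y(2) by (metis ex_in_conv)
    have "y \<le> m" if y: "y \<in> Y" for y
    proof (cases "y = m")
      case False
      then have "(m, y) \<in> R" using tot[of m y] m(2)[OF y] by blast
      moreover have "m \<in> W" "y \<in> W" using m(1) y Y(1) by auto
      ultimately have "y < m" by (auto simp: W_def)
      then show ?thesis by simp
    qed simp
    then show ?thesis using m(1) by blast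
  qed
  then have "scattered (closure W)" by (rule scattered_closure_dually_well_ordered)
  moreover have "\<exists>z\<in>closure W \<inter> T. z \<le> t" if t: "t \<in> T" for t
  proof -
    define Q where "Q = {x \<in> T. x \<le> t}"
    have "Q \<noteq> {}" using t by (auto simp: Q_def)
    then obtain z where "z \<in> Q" "\<And>y. (y, z) \<in> R \<Longrightarrow> y \<notin> Q"
      using wfE_min[OF wf] by (metis ex_in_conv)
    then have z: "z \<in> T" "z \<le> t" "\<And>y. (y, z) \<in> R \<Longrightarrow> y \<in> T \<Longrightarrow> \<not> y \<le> t"
      by (auto simp: Q_def)
    have "z \<in> W" using z unfolding W_def by force
    then show ?thesis using z(1,2) closure_subset[of W] by auto
  qed
  ultimately show thesis by (rule that[OF closed_closure])
qed

section \<open>The increasing sequence of scattered sets\<close>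

text \<open>
  What the next stage \<open>T\<close> has to provide inside a gap \<open>(a, b)\<close> of stage \<open>m\<close>: the right ends of the
  sets that contain \<open>a\<close>, the left ends of those that contain \<open>b\<close>, and points of \<open>T\<close> arbitrarily
  close to both ends of the gap. The bound \<open>n \<le> m\<close> keeps the number of sets united at one stage
  finite, which preserves closedness and scatteredness.
\<close>

definition resolved ::
  "(nat \<Rightarrow> 'a::linorder \<Rightarrow> 'a set) \<Rightarrow> nat \<Rightarrow> 'a set \<Rightarrow> 'a \<Rightarrow> 'a \<Rightarrow> bool" where
  "resolved N m T a b \<longleftrightarrow>
     (\<forall>n\<le>m. \<forall>p q. a \<le> p \<and> p < q \<and> q \<le> b \<and> a \<in> N n p \<and> q \<notin> N n p \<longrightarrow> (\<exists>c\<in>T. p < c \<and> c \<le> q)) \<and>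
     (\<forall>n\<le>m. \<forall>p q. a \<le> q \<and> q < p \<and> p \<le> b \<and> b \<in> N n p \<and> q \<notin> N n p \<longrightarrow> (\<exists>c\<in>T. q \<le> c \<and> c < p)) \<and>
     (\<forall>t\<in>{a<..<b}. (\<exists>z\<in>T. t \<le> z \<and> z < b) \<and> (\<exists>z\<in>T. a < z \<and> z \<le> t))"

lemma resolving_set:
  fixes a b :: "'a::linorder_topology"
  assumes K: "compact (UNIV :: 'a set)" and N: "\<And>n. ranked (N n)"
  obtains X where "closed X" "scattered X" "resolved N m (X \<inter> {a..b}) a b"
proof -
  have "\<forall>n. \<exists>X. closed X \<and> scattered X \<and>
      (\<forall>p q. a \<le> p \<and> p < q \<and> a \<in> N n p \<and> q \<notin> N n p \<longrightarrow> (\<exists>c\<in>X. p < c \<and> c \<le> q))"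
    using right_ends[OF K N] by metis
  then obtain A where A: "\<And>n. closed (A n) \<and> scattered (A n)"
    "\<And>n p q. \<lbrakk>a \<le> p; p < q; a \<in> N n p; q \<notin> N n p\<rbrakk> \<Longrightarrow> \<exists>c\<in>A n. p < c \<and> c \<le> q"
    by metis
  have "\<forall>n. \<exists>X. closed X \<and> scattered X \<and>
      (\<forall>p q. p \<le> b \<and> q < p \<and> b \<in> N n p \<and> q \<notin> N n p \<longrightarrow> (\<exists>c\<in>X. q \<le> c \<and> c < p))"
    using left_ends[OF K N] by metis
  then obtain B where B: "\<And>n. closed (B n) \<and> scattered (B n)"
    "\<And>n p q. \<lbrakk>p \<le> b; q < p; b \<in> N n p; q \<notin> N n p\<rbrakk> \<Longrightarrow> \<exists>c\<in>B n. q \<le> c \<and> c < p"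
    by metis
  obtain C where C: "closed C" "scattered C" "\<And>t. t \<in> {a<..<b} \<Longrightarrow> \<exists>z\<in>C \<inter> {a<..<b}. t \<le> z"
    using cofinal_scattered by metis
  obtain D where D: "closed D" "scattered D" "\<And>t. t \<in> {a<..<b} \<Longrightarrow> \<exists>z\<in>D \<inter> {a<..<b}. z \<le> t"
    using coinitial_scattered by metis
  define X where "X = (\<Union>n\<in>{..m}. A n) \<union> ((\<Union>n\<in>{..m}. B n) \<union> (C \<union> D))"
  have "closed X" unfolding X_def using A(1) B(1) C(1) D(1) by (intro closed_Un closed_UN) auto
  moreover have "scattered X" unfolding X_def
    using A(1) B(1) C(1,2) D(2) by (intro scattered_Un scattered_UN_finite) auto
  moreover have "resolved N m (X \<inter> {a..b}) a b"
    unfolding resolved_def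
  proof (intro conjI allI impI ballI; (elim conjE)?)
    fix n p q assume "n \<le> m" and h: "a \<le> p" "p < q" "q \<le> b" "a \<in> N n p" "q \<notin> N n p"
    obtain c where "c \<in> A n" "p < c" "c \<le> q" using A(2)[OF h(1,2,4,5)] by blast
    then show "\<exists>c\<in>X \<inter> {a..b}. p < c \<and> c \<le> q"
      using \<open>n \<le> m\<close> h by (intro bexI[of _ c]) (auto simp: X_def)
  next
    fix n p q assume "n \<le> m" and h: "a \<le> q" "q < p" "p \<le> b" "b \<in> N n p" "q \<notin> N n p"
    obtain c where "c \<in> B n" "q \<le> c" "c < p" using B(2)[OF h(3,2,4,5)] by blast
    then show "\<exists>c\<in>X \<inter> {a..b}. q \<le> c \<and> c < p"
      using \<open>n \<le> m\<close> h by (intro bexI[of _ c]) (auto simp: X_def)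
  next
    fix t assume "t \<in> {a<..<b}"
    from C(3)[OF this] obtain z where "z \<in> C" "a < z" "z < b" "t \<le> z" by auto
    then show "\<exists>z\<in>X \<inter> {a..b}. t \<le> z \<and> z < b"
      by (intro bexI[of _ z]) (auto simp: X_def)
  next
    fix t assume "t \<in> {a<..<b}"
    from D(3)[OF this] obtain z where "z \<in> D" "a < z" "z < b" "z \<le> t" by auto
    then show "\<exists>z\<in>X \<inter> {a..b}. a < z \<and> z \<le> t"
      by (intro bexI[of _ z]) (auto simp: X_def)
  qed
  ultimately show thesis using that by blast
qed

lemma resolved_mono: "resolved N m T a b \<Longrightarrow> T \<subseteq> T' \<Longrightarrow> resolved N m T' a b"
  unfolding resolved_def by (simp add: Ball_def) (meson subsetD)

lemma resolving_sequence:
  fixes N :: "nat \<Rightarrow> 'a::linorder_topology \<Rightarrow> 'a set"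
  assumes K: "compact (UNIV :: 'a set)" and N: "\<And>n. ranked (N n)"
    and lu: "\<And>x. l \<le> x" "\<And>x. x \<le> u"
  obtains S where "\<And>m. closed (S m)" "\<And>m. scattered (S m)" "\<And>m. l \<in> S m" "\<And>m. u \<in> S m"
    "\<And>m. S m \<subseteq> S (Suc m)" "\<And>m a b. gap (S m) a b \<Longrightarrow> resolved N m (S (Suc m)) a b"
proof -
  let ?P = "\<lambda>S. closed S \<and> scattered S \<and> l \<in> S \<and> u \<in> S"
  have "\<exists>S. \<forall>m. ?P (S m) \<and> (S m \<subseteq> S (Suc m) \<and> (\<forall>a b. gap (S m) a b \<longrightarrow> resolved N m (S (Suc m)) a b))"
  proof (rule dependent_nat_choice)
    have "scattered ({l} \<union> {u})" by (rule scattered_Un) auto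
    then show "\<exists>S. ?P S" by (intro exI[of _ "{l} \<union> {u}"]) auto
  next
    fix S m assume S: "?P S"
    have "\<exists>X. closed X \<and> scattered X \<and> resolved N m (X \<inter> {a..b}) a b" for a b
      by (rule resolving_set[where N = N and m = m and a = a and b = b, OF K N]) blast
    then obtain X where X: "\<And>a b. closed (X a b) \<and> scattered (X a b)"
      "\<And>a b. resolved N m (X a b \<inter> {a..b}) a b" by metis
    define T where "T = S \<union> (\<Union>(a, b)\<in>{(a, b). gap S a b}. X a b \<inter> {a..b})"
    have "closed T" "scattered T"
      unfolding T_def using closed_scattered_fill_gaps[OF K, of S l u X] S lu X(1) by auto
    moreover have "resolved N m T a b" if "gap S a b" for a b
      using X(2) by (rule resolved_mono) (use that in \<open>auto simp: T_def\<close>)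
    moreover have "S \<subseteq> T" by (auto simp: T_def)
    ultimately show "\<exists>T. ?P T \<and> (S \<subseteq> T \<and> (\<forall>a b. gap S a b \<longrightarrow> resolved N m T a b))"
      using S by blast
  qed
  then show thesis using that by blast
qed

lemma gap_empty_endpoints:
  assumes "a \<le> x" "x < y" "y \<le> b" "{a<..<b} = {}"
  shows "x = a" "y = (b::'a::linorder)"
proof -
  have "x \<notin> {a<..<b}" "y \<notin> {a<..<b}" using assms(4) by auto
  then show "x = a" "y = b" using assms(1-3) by auto
qed

text \<open>
  The argument uses three consecutive stages. At stage \<open>M\<close> the gap is so narrow that its left end lies
  in \<open>N n p\<close>; stage \<open>M + 1\<close> contains an end point of \<open>N n p\<close>, so the right end of its gap is already
  the limit \<open>q\<close>; stage \<open>M + 2\<close> is cofinal below \<open>q\<close>, which leaves its gap without inner points.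
  The case with \<open>p\<close> and \<open>q\<close> exchanged is symmetric.
\<close>

lemma resolving_sequence_separates:
  fixes N :: "nat \<Rightarrow> 'a::linorder_topology \<Rightarrow> 'a set"
  assumes K: "compact (UNIV :: 'a set)"
    and N: "\<And>n p. open (N n p)" "\<And>n p. p \<in> N n p"
    and sep: "\<And>p q. p \<noteq> q \<Longrightarrow> \<exists>n. q \<notin> N n p \<or> p \<notin> N n q"
    and lu: "\<And>x. l \<le> x" "\<And>x. x \<le> u"
    and S: "\<And>m. closed (S m)" "\<And>m. l \<in> S m" "\<And>m. u \<in> S m" "\<And>m. S m \<subseteq> S (Suc m)"
    and res: "\<And>m a b. gap (S m) a b \<Longrightarrow> resolved N m (S (Suc m)) a b"
    and xy: "x < y"
  shows "\<exists>m. \<exists>u\<in>S m. \<exists>v\<in>S m. x \<le> u \<and> u < v \<and> v \<le> y"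
proof (rule ccontr)
  assume contra: "\<not> ?thesis"
  then have two: False if "u \<in> S m" "v \<in> S m" "x \<le> u" "u < v" "v \<le> y" for u v m
    using that by blast
  have S_mono: "S m \<subseteq> S n" if "m \<le> n" for m n using lift_Suc_mono_le[of S, OF S(4) that] .
  \<comment> \<open>Cutting \<open>[x, y]\<close> at its only possible inner point of the stages leaves an interval whose inside
    is missed by every stage.\<close>
  obtain x' y' where xy': "x \<le> x'" "x' < y'" "y' \<le> y" "\<And>m. S m \<inter> {x'<..<y'} = {}"
  proof (cases "\<exists>m s. s \<in> S m \<and> x < s \<and> s < y")
    case True
    then obtain m s where s: "s \<in> S m" "x < s" "s < y" by blast
    have "False" if "t \<in> S k" "x < t" "t < s" for t k
    proof -
      have "t \<in> S (max m k)" "s \<in> S (max m k)"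
        using s(1) that(1) S_mono[of m "max m k"] S_mono[of k "max m k"] by auto
      then show False using two s(3) that by (meson less_imp_le)
    qed
    then have "S k \<inter> {x<..<s} = {}" for k by auto
    then show thesis using that[of x s] s by auto
  next
    case False
    then have "S k \<inter> {x<..<y} = {}" for k by auto
    then show thesis using that[of x y] xy by auto
  qed
  have not_both: False if "x' \<in> S m" "y' \<in> S m" for m
    using two[OF that xy'(1-3)] .
  have "\<forall>m. \<exists>a b. gap (S m) a b \<and> a \<le> x' \<and> y' \<le> b"
    using gap_around[OF K S(1-3) lu] xy' by (metis less_imp_le)
  then obtain a b where gap: "\<And>m. gap (S m) (a m) (b m)" and ax: "\<And>m. a m \<le> x'"
    and yb: "\<And>m. y' \<le> b m"
    by metis
  have outside: "s \<le> a m \<or> b m \<le> s" if "s \<in> S m" for s m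
    using gap[of m] that unfolding gap_def by force
  have a_mono: "a m \<le> a n" and b_mono: "b n \<le> b m" if "m \<le> n" for m n
  proof -
    have "a m \<in> S n" "b m \<in> S n" using gap[of m] S_mono[OF that] by (auto simp: gap_def)
    from outside[OF this(1)] outside[OF this(2)] show "a m \<le> a n" "b n \<le> b m"
      using ax[of m] ax[of n] yb[of n] yb[of m] xy'(2) by auto
  qed
  have comp: "compact (C :: 'a set)" if "closed C" for C
    using compact_Int_closed[OF K that] by simp
  \<comment> \<open>Suprema and infima are taken as extrema of closed sets of bounds, which exist by compactness.\<close>
  have "closed (\<Inter>m. {a m..})" "x' \<in> (\<Inter>m. {a m..})" using ax by auto
  then obtain p where "p \<in> (\<Inter>m. {a m..})" "\<And>z. z \<in> (\<Inter>m. {a m..}) \<Longrightarrow> p \<le> z"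
    using compact_attains_inf[OF comp] by (metis empty_iff)
  then have p: "\<And>m. a m \<le> p" "\<And>z. (\<And>m. a m \<le> z) \<Longrightarrow> p \<le> z" by auto
  have "closed (\<Inter>m. {..b m})" "y' \<in> (\<Inter>m. {..b m})" using yb by auto
  then obtain q where "q \<in> (\<Inter>m. {..b m})" "\<And>z. z \<in> (\<Inter>m. {..b m}) \<Longrightarrow> z \<le> q"
    using compact_attains_sup[OF comp] by (metis empty_iff)
  then have q: "\<And>m. q \<le> b m" "\<And>z. (\<And>m. z \<le> b m) \<Longrightarrow> z \<le> q" by auto
  have px: "p \<le> x'" and yq: "y' \<le> q" using p(2) q(2) ax yb by auto
  then have pq: "p < q" using xy'(2) by simp
  obtain n where "q \<notin> N n p \<or> p \<notin> N n q" using sep[of p q] pq by auto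
  then show False
  proof
    assume n: "q \<notin> N n p"
    obtain M where M: "n \<le> M" "a M \<in> N n p"
    proof (cases "\<exists>z. z < p")
      case True
      then obtain z where z: "z < p" "{z<..p} \<subseteq> N n p" using open_left[OF N(1,2)] by blast
      then obtain k where "z < a k" using p(2)[of z] by (meson leD not_le)
      then have "z < a (max n k)" using a_mono[of k "max n k"] by simp
      then show thesis using that[of "max n k"] z(2) p(1)[of "max n k"] by auto
    next
      case False
      then have "a n = p" using p(1)[of n] by (metis order_le_less)
      then show thesis using that[of n] N(2) by simp
    qed
    obtain c where c: "c \<in> S (Suc M)" "p < c" "c \<le> q"
      using res[OF gap[of M]] M n pq p(1)[of M] q(1)[of M] unfolding resolved_def by blast
    have bM: "b (Suc M) = q" using outside[OF c(1)] c p(1)[of "Suc M"] q(1)[of "Suc M"] by auto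
    then have bM': "b (Suc (Suc M)) = q"
      using b_mono[of "Suc M" "Suc (Suc M)"] q(1)[of "Suc (Suc M)"] by simp
    have "False" if t: "t \<in> {a (Suc (Suc M))<..<q}" for t
    proof -
      have "t \<in> {a (Suc M)<..<b (Suc M)}" using t bM a_mono[of "Suc M" "Suc (Suc M)"] by auto
      then obtain z where "z \<in> S (Suc (Suc M))" "t \<le> z" "z < q"
        using res[OF gap[of "Suc M"]] bM unfolding resolved_def by metis
      then show False using outside[of z "Suc (Suc M)"] bM' t by auto
    qed
    then have "{a (Suc (Suc M))<..<b (Suc (Suc M))} = {}" using bM' by blast
    from gap_empty_endpoints[OF ax xy'(2) yb this] show False
      using gap[of "Suc (Suc M)"] not_both[of "Suc (Suc M)"] by (simp add: gap_def)
  next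
    assume n: "p \<notin> N n q"
    obtain M where M: "n \<le> M" "b M \<in> N n q"
    proof (cases "\<exists>z. q < z")
      case True
      then obtain z where z: "q < z" "{q..<z} \<subseteq> N n q" using open_right[OF N(1,2)] by blast
      then obtain k where "b k < z" using q(2)[of z] by (meson leD not_le)
      then have "b (max n k) < z" using b_mono[of k "max n k"] by simp
      then show thesis using that[of "max n k"] z(2) q(1)[of "max n k"] by auto
    next
      case False
      then have "b n = q" using q(1)[of n] by (metis order_le_less)
      then show thesis using that[of n] N(2) by simp
    qed
    obtain c where c: "c \<in> S (Suc M)" "p \<le> c" "c < q"
      using res[OF gap[of M]] M n pq p(1)[of M] q(1)[of M] unfolding resolved_def by blast
    have aM: "a (Suc M) = p" using outside[OF c(1)] c p(1)[of "Suc M"] q(1)[of "Suc M"] by auto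
    then have aM': "a (Suc (Suc M)) = p"
      using a_mono[of "Suc M" "Suc (Suc M)"] p(1)[of "Suc (Suc M)"] by simp
    have "False" if t: "t \<in> {p<..<b (Suc (Suc M))}" for t
    proof -
      have "t \<in> {a (Suc M)<..<b (Suc M)}" using t aM b_mono[of "Suc M" "Suc (Suc M)"] by auto
      then obtain z where "z \<in> S (Suc (Suc M))" "p < z" "z \<le> t"
        using res[OF gap[of "Suc M"]] aM unfolding resolved_def by metis
      then show False using outside[of z "Suc (Suc M)"] aM' t by auto
    qed
    then have "{a (Suc (Suc M))<..<b (Suc (Suc M))} = {}" using aM' by blast
    from gap_empty_endpoints[OF ax xy'(2) yb this] show False
      using gap[of "Suc (Suc M)"] not_both[of "Suc (Suc M)"] by (simp add: gap_def)
  qed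
qed

section \<open>A lower semicontinuous fragmenting metric\<close>

lemma gaps_disjoint:
  assumes "gap S a b" "gap S a' b'"
  shows "(a' = a \<and> b' = b) \<or> b' \<le> a \<or> b \<le> a'"
proof -
  have "a \<le> a' \<or> b' \<le> a" "a' \<le> a \<or> b \<le> a'" "b \<le> b' \<or> b' \<le> a" "b' \<le> b \<or> b \<le> a'"
    using assms unfolding gap_def by force+
  then show ?thesis by (metis order.antisym)
qed

lemma Urysohn_line:
  fixes a b :: "'a::linorder_topology"
  assumes K: "compact (UNIV :: 'a set)" and "a < b"
  obtains f :: "'a \<Rightarrow> real" where "continuous_on UNIV f" "\<And>x. 0 \<le> f x \<and> f x \<le> 1"
    "\<And>x. x \<le> a \<Longrightarrow> f x = 0" "\<And>x. b \<le> x \<Longrightarrow> f x = 1"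
proof -
  have "Hausdorff_space (euclidean :: 'a topology)"
    by (simp add: Hausdorff_space_def disjnt_def) (metis hausdorff)
  then have "normal_space (euclidean :: 'a topology)"
    using K by (intro compact_Hausdorff_or_regular_imp_normal_space) (auto simp: compact_space_def)
  moreover have "disjnt {..a} {b..}" using \<open>a < b\<close> by (auto simp: disjnt_def)
  ultimately obtain f :: "'a \<Rightarrow> real" where
    "continuous_map euclidean (top_of_set {0..1}) f" "f ` {..a} \<subseteq> {0}" "f ` {b..} \<subseteq> {1}"
    using Urysohn_lemma[of euclidean "{..a}" "{b..}" 0 "1::real"] by auto
  then show thesis by (intro that[of f]) (auto simp: continuous_map_in_subtopology image_subset_iff)
qed

text \<open>
  If \<open>Y\<close> meets an open interval bounded by a gap of \<open>S\<close>, all functions belonging to the other gaps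
  are constant on it, so only the continuity of a single function matters. Otherwise \<open>Y \<subseteq> S\<close> has an
  isolated point.
\<close>

lemma gap_functions_small_oscillation:
  fixes S :: "'a::linorder_topology set" and f :: "'a \<Rightarrow> 'a \<Rightarrow> 'a \<Rightarrow> real"
  assumes K: "compact (UNIV :: 'a set)" and S: "closed S" "scattered S"
    and lu: "l \<in> S" "u \<in> S" "\<And>x. l \<le> x" "\<And>x. x \<le> u"
    and f: "\<And>a b. gap S a b \<Longrightarrow> continuous_on UNIV (f a b)"
      "\<And>a b x. gap S a b \<Longrightarrow> x \<le> a \<Longrightarrow> f a b x = 0"
      "\<And>a b x. gap S a b \<Longrightarrow> b \<le> x \<Longrightarrow> f a b x = 1"
    and Y: "Y \<noteq> {}" and "\<epsilon> > 0"
  obtains U where "open U" "U \<inter> Y \<noteq> {}"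
    "\<And>a b x y. \<lbrakk>gap S a b; x \<in> U \<inter> Y; y \<in> U \<inter> Y\<rbrakk> \<Longrightarrow> \<bar>f a b x - f a b y\<bar> < \<epsilon>"
proof (cases "Y \<subseteq> S")
  case True
  then obtain U y where U: "open U" "U \<inter> Y = {y}" using scatteredE[OF S(2) _ Y] by metis
  show thesis by (rule that[OF U(1)]) (use U(2) \<open>\<epsilon> > 0\<close> in auto)
next
  case False
  then obtain y where y: "y \<in> Y" "y \<notin> S" by blast
  obtain a b where g: "gap S a b" "a \<le> y" "y \<le> b"
    using gap_around[OF K S(1) lu(1,2) lu(3,4), of y y] y by auto
  have "a < y" "y < b" using g y(2) unfolding gap_def by (metis order_le_less)+
  define U where "U = {a<..<b} \<inter> {z. \<bar>f a b z - f a b y\<bar> < \<epsilon> / 2}"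
  have "open {z. \<bar>f a b z - f a b y\<bar> < \<epsilon> / 2}"
    by (intro open_Collect_less continuous_intros f(1)[OF g(1)])
  then have "open U" by (auto simp: U_def)
  moreover have "y \<in> U \<inter> Y" using y \<open>a < y\<close> \<open>y < b\<close> \<open>\<epsilon> > 0\<close> by (auto simp: U_def)
  moreover have "\<bar>f a' b' x - f a' b' z\<bar> < \<epsilon>"
    if g': "gap S a' b'" and xz: "x \<in> U \<inter> Y" "z \<in> U \<inter> Y" for a' b' x z
  proof -
    have in_gap: "a < x" "x < b" "a < z" "z < b"
      and close: "\<bar>f a b x - f a b y\<bar> < \<epsilon> / 2" "\<bar>f a b z - f a b y\<bar> < \<epsilon> / 2"
      using xz by (auto simp: U_def)
    consider "a' = a" "b' = b" | "b' \<le> a" | "b \<le> a'" using gaps_disjoint[OF g(1) g'] by blast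
    then show ?thesis
    proof cases
      case 1
      then have "\<bar>f a' b' x - f a' b' z\<bar> = \<bar>f a b x - f a b z\<bar>" by simp
      then show ?thesis using close by linarith
    next
      case 2
      then have "b' \<le> x" "b' \<le> z" using in_gap by auto
      then show ?thesis using f(3)[OF g'] \<open>\<epsilon> > 0\<close> by simp
    next
      case 3
      then have "x \<le> a'" "z \<le> a'" using in_gap by auto
      then show ?thesis using f(2)[OF g'] \<open>\<epsilon> > 0\<close> by simp
    qed
  qed
  ultimately show thesis using that[of U] by blast
qed

lemma small_open_set_finitely_many_stages:
  fixes P :: "nat \<Rightarrow> 'a::topological_space \<Rightarrow> 'a \<Rightarrow> bool"
  assumes "\<And>n Y. Y \<noteq> {} \<Longrightarrow> \<exists>U. open U \<and> U \<inter> Y \<noteq> {} \<and> (\<forall>x\<in>U \<inter> Y. \<forall>y\<in>U \<inter> Y. P n x y)"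
    and "Y \<noteq> {}"
  shows "\<exists>U. open U \<and> U \<inter> Y \<noteq> {} \<and> (\<forall>n<m. \<forall>x\<in>U \<inter> Y. \<forall>y\<in>U \<inter> Y. P n x y)"
proof (induction m)
  case 0
  then show ?case using assms(2) by (intro exI[of _ UNIV]) auto
next
  case (Suc m)
  then obtain U where U: "open U" "U \<inter> Y \<noteq> {}"
    "\<forall>n<m. \<forall>x\<in>U \<inter> Y. \<forall>y\<in>U \<inter> Y. P n x y" by blast
  obtain V where V: "open V" "V \<inter> (U \<inter> Y) \<noteq> {}"
    "\<forall>x\<in>V \<inter> (U \<inter> Y). \<forall>y\<in>V \<inter> (U \<inter> Y). P m x y" using assms(1)[OF U(2), of m] by blast
  have "open (V \<inter> U)" "(V \<inter> U) \<inter> Y \<noteq> {}" using U(1) V(1,2) by auto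
  moreover have "\<forall>n<Suc m. \<forall>x\<in>(V \<inter> U) \<inter> Y. \<forall>y\<in>(V \<inter> U) \<inter> Y. P n x y"
    using U(3) V(3) by (auto simp: less_Suc_eq)
  ultimately show ?case by blast
qed

text \<open>
  The factor \<open>1 / 2 ^ n\<close> makes all but finitely many stages negligible for a given \<open>\<epsilon>\<close>, and the
  remaining stages are treated one after the other by passing to smaller relatively open sets.
\<close>

lemma Radon_Nikodym_if_separated_by_scattered:
  fixes S :: "nat \<Rightarrow> 'a::linorder_topology set"
  assumes K: "compact (UNIV :: 'a set)"
    and S: "\<And>m. closed (S m)" "\<And>m. scattered (S m)"
    and lu: "\<And>m. l \<in> S m" "\<And>m. u \<in> S m" "\<And>x. l \<le> x" "\<And>x. x \<le> u"
    and sep: "\<And>x y. x < y \<Longrightarrow> \<exists>m. \<exists>u\<in>S m. \<exists>v\<in>S m. x \<le> u \<and> u < v \<and> v \<le> y"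
  shows "Radon_Nikodym_compact (euclidean :: 'a topology)"
proof -
  have "\<exists>f :: 'a \<Rightarrow> real. continuous_on UNIV f \<and> (\<forall>x. 0 \<le> f x \<and> f x \<le> 1) \<and>
      (\<forall>x\<le>a. f x = 0) \<and> (\<forall>x\<ge>b. f x = 1)" if "a < b" for a b :: 'a
    by (rule Urysohn_line[OF K that]) blast
  then obtain f :: "'a \<Rightarrow> 'a \<Rightarrow> 'a \<Rightarrow> real" where f: "\<And>a b. a < b \<Longrightarrow>
      continuous_on UNIV (f a b) \<and> (\<forall>x. 0 \<le> f a b x \<and> f a b x \<le> 1) \<and>
      (\<forall>x\<le>a. f a b x = 0) \<and> (\<forall>x\<ge>b. f a b x = 1)"
    by metis
  have gap_less: "a < b" if "gap (S n) a b" for n a b using that by (simp add: gap_def)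
  \<comment> \<open>The zero functions for non-gaps make the index set nonempty even if there are no gaps at all.\<close>
  define g :: "nat \<times> 'a \<times> 'a \<Rightarrow> 'a \<Rightarrow> real" where
    "g = (\<lambda>(n, a, b) x. if gap (S n) a b then f a b x / 2 ^ n else 0)"
  have g_cont: "continuous_on UNIV (g i)" for i
  proof -
    obtain n a b where i: "i = (n, a, b)" by (cases i) auto
    show ?thesis
    proof (cases "gap (S n) a b")
      case True
      then have "continuous_on UNIV (\<lambda>x. f a b x / 2 ^ n)"
        using f[OF gap_less[OF True]] by (intro continuous_intros) auto
      then show ?thesis using True i by (simp add: g_def)
    qed (simp add: g_def i)
  qed
  have g_range: "0 \<le> g (n, a, b) x \<and> g (n, a, b) x \<le> 1 / 2 ^ n" for n a b x
    using f[OF gap_less] by (auto simp: g_def divide_right_mono)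
  have g_diff: "\<bar>g (n, a, b) x - g (n, a, b) y\<bar> \<le> 1 / 2 ^ n" for n a b x y
    using g_range[of n a b x] g_range[of n a b y] by linarith
  have g_diff_1: "\<bar>g i x - g i y\<bar> \<le> 1" for i x y
  proof -
    obtain n a b where i: "i = (n, a, b)" by (cases i) auto
    have "1 / 2 ^ n \<le> (1 :: real)" by simp
    with g_diff[of n a b x y] show ?thesis unfolding i by (rule order_trans)
  qed
  define d where "d x y = (SUP i. \<bar>g i x - g i y\<bar>)" for x y
  have bdd: "bdd_above (range (\<lambda>i. \<bar>g i x - g i y\<bar>))" for x y
    using g_diff_1 by (intro bdd_aboveI[of _ 1]) auto
  have upper: "\<bar>g i x - g i y\<bar> \<le> d x y" for i x y
    unfolding d_def by (rule cSUP_upper[OF _ bdd]) simp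
  have le_iff: "d x y \<le> r \<longleftrightarrow> (\<forall>i. \<bar>g i x - g i y\<bar> \<le> r)" for x y r
    unfolding d_def by (subst cSUP_le_iff[OF _ bdd]) auto
  have pos: "d x y \<noteq> 0" if "x < y" for x y
  proof -
    obtain m u v where "u \<in> S m" "v \<in> S m" "x \<le> u" "u < v" "v \<le> y" using sep[OF \<open>x < y\<close>] by blast
    moreover obtain a b where ab: "gap (S m) a b" "u \<le> a" "b \<le> v"
      using gap_between[OF K S calculation(1,2,4)] by blast
    ultimately have "x \<le> a" "b \<le> y" by auto
    then have "g (m, a, b) x = 0" "g (m, a, b) y = 1 / 2 ^ m"
      using f[OF gap_less[OF ab(1)]] ab(1) by (auto simp: g_def)
    then have "1 / 2 ^ m \<le> d x y" using upper[of "(m, a, b)" x y] by simp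
    moreover have "(0 :: real) < 1 / 2 ^ m" by simp
    ultimately show ?thesis by linarith
  qed
  have commute: "d x y = d y x" for x y by (simp add: d_def abs_minus_commute)
  have "Metric_space UNIV d"
  proof
    show "0 \<le> d x y" for x y using upper[of undefined x y] by linarith
    show "d x y = d y x" for x y by (rule commute)
    show "d x y = 0 \<longleftrightarrow> x = y" for x y
    proof
      show "x = y" if "d x y = 0"
        using that pos[of x y] pos[of y x] commute[of x y] by (cases x y rule: linorder_cases) auto
    qed (simp add: d_def)
    show "d x z \<le> d x y + d y z" for x y z
      unfolding le_iff
    proof
      fix i
      show "\<bar>g i x - g i z\<bar> \<le> d x y + d y z" using upper[of i x y] upper[of i y z] by linarith
    qed
  qed
  moreover have "lower_semicontinuous_metric d (euclidean :: 'a topology)"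
    unfolding lower_semicontinuous_metric_def
  proof (intro allI impI)
    fix r :: real
    have "closed {p. \<bar>g i (fst p) - g i (snd p)\<bar> \<le> r}" for i
      by (intro closed_Collect_le continuous_intros continuous_on_compose2[OF g_cont]) auto
    then have "closed (\<Inter>i. {p. \<bar>g i (fst p) - g i (snd p)\<bar> \<le> r})" by (intro closed_INT) auto
    moreover have "{(x, y) \<in> topspace euclidean \<times> topspace euclidean. d x y \<le> r} =
        (\<Inter>i. {p. \<bar>g i (fst p) - g i (snd p)\<bar> \<le> r})"
      by (auto simp: le_iff)
    ultimately show "closedin (prod_topology euclidean euclidean)
        {(x, y) \<in> topspace (euclidean :: 'a topology) \<times> topspace euclidean. d x y \<le> r}"
      by simp
  qed
  moreover have "fragments d (euclidean :: 'a topology)"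
    unfolding fragments_def
  proof (intro allI impI, elim conjE)
    fix Y :: "'a set" and \<epsilon> :: real
    assume Y: "Y \<noteq> {}" and eps: "\<epsilon> > 0"
    obtain m where m: "1 / 2 ^ m < \<epsilon> / 2"
      using real_arch_pow_inv[of "\<epsilon> / 2" "1 / 2"] eps by (auto simp: power_one_over)
    define P where "P n x y \<longleftrightarrow> (\<forall>a b. \<bar>g (n, a, b) x - g (n, a, b) y\<bar> < \<epsilon> / 2)" for n x y
    have "\<exists>U. open U \<and> U \<inter> Y' \<noteq> {} \<and> (\<forall>x\<in>U \<inter> Y'. \<forall>y\<in>U \<inter> Y'. P n x y)"
      if "Y' \<noteq> {}" for n and Y' :: "'a set"
    proof -
      have "\<And>a b. gap (S n) a b \<Longrightarrow> continuous_on UNIV (f a b)"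
        "\<And>a b x. gap (S n) a b \<Longrightarrow> x \<le> a \<Longrightarrow> f a b x = 0"
        "\<And>a b x. gap (S n) a b \<Longrightarrow> b \<le> x \<Longrightarrow> f a b x = 1"
        using f[OF gap_less] by auto
      from gap_functions_small_oscillation[where S = "S n" and f = f and Y = Y' and \<epsilon> = "\<epsilon> / 2",
          OF K S lu this that half_gt_zero[OF eps]]
      obtain U where U: "open U" "U \<inter> Y' \<noteq> {}"
        "\<And>a b x y. \<lbrakk>gap (S n) a b; x \<in> U \<inter> Y'; y \<in> U \<inter> Y'\<rbrakk> \<Longrightarrow> \<bar>f a b x - f a b y\<bar> < \<epsilon> / 2"
        by metis
      have "P n x y" if "x \<in> U \<inter> Y'" "y \<in> U \<inter> Y'" for x y
        unfolding P_def
      proof (intro allI)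
        fix a b
        show "\<bar>g (n, a, b) x - g (n, a, b) y\<bar> < \<epsilon> / 2"
        proof (cases "gap (S n) a b")
          case True
          then have "\<bar>g (n, a, b) x - g (n, a, b) y\<bar> = \<bar>f a b x - f a b y\<bar> / 2 ^ n"
            by (simp add: g_def flip: diff_divide_distrib)
          also have "\<dots> \<le> \<bar>f a b x - f a b y\<bar> / 1"
            by (intro divide_left_mono) auto
          finally show ?thesis using U(3)[OF True that] by simp
        qed (use eps in \<open>simp add: g_def\<close>)
      qed
      then show ?thesis using U(1,2) by blast
    qed
    from small_open_set_finitely_many_stages[of P Y m, OF this Y] obtain U where U: "open U" "U \<inter> Y \<noteq> {}"
      "\<And>n x y. \<lbrakk>n < m; x \<in> U \<inter> Y; y \<in> U \<inter> Y\<rbrakk> \<Longrightarrow> P n x y" by blast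
    have small: "d x y \<le> \<epsilon> / 2" if "x \<in> U \<inter> Y" "y \<in> U \<inter> Y" for x y
      unfolding le_iff
    proof
      fix i :: "nat \<times> 'a \<times> 'a"
      obtain n a b where i: "i = (n, a, b)" by (cases i) auto
      show "\<bar>g i x - g i y\<bar> \<le> \<epsilon> / 2"
      proof (cases "n < m")
        case True
        then show ?thesis using U(3)[OF True that] i by (auto simp: P_def intro: less_imp_le)
      next
        case False
        then have "1 / 2 ^ n \<le> (1 :: real) / 2 ^ m" by (intro divide_left_mono power_increasing) auto
        then show ?thesis using g_diff[of n a b x y] m unfolding i by linarith
      qed
    qed
    have "(SUP (x, y) \<in> (U \<inter> Y) \<times> (U \<inter> Y). ereal (d x y)) \<le> ereal (\<epsilon> / 2)"
      using small by (intro SUP_least) auto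
    also have "\<dots> < ereal \<epsilon>" using eps by simp
    finally have "(SUP (x, y) \<in> (U \<inter> Y) \<times> (U \<inter> Y). ereal (d x y)) < ereal \<epsilon>" .
    moreover have "openin (subtopology euclidean Y) (U \<inter> Y)"
      using U(1) by (auto simp: openin_open)
    ultimately show "\<exists>V. openin (subtopology euclidean Y) V \<and> V \<noteq> {} \<and>
        (SUP (x, y) \<in> V \<times> V. ereal (d x y)) < ereal \<epsilon>"
      using U(2) by blast
  qed
  ultimately show ?thesis
    using K unfolding Radon_Nikodym_compact_def by (auto simp: compact_space_def)
qed

theorem theorem3p2:
  assumes "compact_space (euclidean :: 'a::linorder_topology topology)"
    and "fragmentable_compact (euclidean :: 'a topology)"
  shows "Radon_Nikodym_compact (euclidean :: 'a topology)"
proof -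
  have K: "compact (UNIV :: 'a set)" using assms(1) by (simp add: compact_space_def)
  obtain d :: "'a \<Rightarrow> 'a \<Rightarrow> real" where d: "Metric_space UNIV d" "fragments d (euclidean :: 'a topology)"
    using assms(2) unfolding fragmentable_compact_def by auto
  have "\<exists>N. ranked N \<and> (\<forall>p q. N p = N q \<longrightarrow> d p q < 1 / real (Suc n))" for n
    by (rule ranked_neighbourhoods[OF d(2), of "1 / real (Suc n)"]) auto
  then obtain N where N: "\<And>n. ranked (N n)"
    "\<And>n p q. N n p = N n q \<Longrightarrow> d p q < 1 / real (Suc n)" by metis
  \<comment> \<open>If each of \<open>p\<close> and \<open>q\<close> lies in the neighbourhood of the other, then they have the same
    neighbourhood, hence distance below \<open>1/(n+1)\<close>; this cannot hold for all \<open>n\<close>.\<close>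
  have sep: "\<exists>n. q \<notin> N n p \<or> p \<notin> N n q" if "p \<noteq> q" for p q
  proof -
    have "0 < d p q" using Metric_space.mdist_pos_less[OF d(1) that] by simp
    then obtain n where "1 / real (Suc n) < d p q" using nat_approx_posE by blast
    then have "N n p \<noteq> N n q" using N(2)[of n p q] by auto
    then show ?thesis using ranked_mutual_imp_eq[OF N(1)] by blast
  qed
  obtain l where l: "\<And>x :: 'a. l \<le> x" using compact_attains_inf[OF K] by auto
  obtain u where u: "\<And>x :: 'a. x \<le> u" using compact_attains_sup[OF K] by auto
  obtain S where S: "\<And>m. closed (S m)" "\<And>m. scattered (S m)" "\<And>m. l \<in> S m" "\<And>m. u \<in> S m"
    "\<And>m. S m \<subseteq> S (Suc m)" "\<And>m a b. gap (S m) a b \<Longrightarrow> resolved N m (S (Suc m)) a b"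
    using resolving_sequence[of N l u, OF K N(1) l u] by metis
  show ?thesis
    using S(1,2,3,4) l u
  proof (rule Radon_Nikodym_if_separated_by_scattered[OF K])
    show "\<exists>m. \<exists>u\<in>S m. \<exists>v\<in>S m. x \<le> u \<and> u < v \<and> v \<le> y" if "x < y" for x y
      by (rule resolving_sequence_separates[OF K rankedD(1)[OF N(1)] rankedD(3)[OF N(1)]
            sep l u S(1,3,4,5,6) that])
  qed
qed

end
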